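(* Let $w(x_1,\dots,x_t)$ be a multilinear element of the free (non-associative) algebra over a field $F$. Then, in any algebra over $F$, the intersection of all finite-codimensional ideals which are maximal (by inclusion) among all ideals satisfying the identity $w(x_1,\dots,x_t)=0$ has finite codimension. Moreover, the intersection of all such ideals of codimension $\le n$ has codimension not larger than some number depending only on $n$ and $t$. Here the word "ideal" can be understood (throughout the statement) in any one of the following senses: left ideal, right ideal, two-sided ideal, or simply subspace.
   Context: Algebras are possibly non-associative. Multilinear means linear in each of $x_1,\dots,x_t$ in the usual sense. A subspace (or ideal) $N$ satisfies the identity $w(x_1,\dots,x_t)=0$ if $w(a_1,\dots,a_t)=0$ for all $a_1,\dots,a_t\in N$. The ideals considered are those of finite codimension that are maximal elements, with respect to inclusion, of the set of all ideals (in the chosen sense) of the algebra satisfying the identity. *)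

theory Defs
  imports Complex_Main "HOL-Library.Poly_Mapping"
begin

text \<open>
  The free (non-associative, non-unital) algebra over a field \<open>'f\<close> on variables indexed by
  natural numbers is the vector space with basis the free magma on those variables, so its
  elements are the finitely supported functions from magma words to \<open>'f\<close>.
\<close>

datatype magma_word = Var nat | Prod magma_word magma_word

type_synonym 'f free_algebra = "magma_word \<Rightarrow>\<^sub>0 'f"

primrec occurrences :: "nat \<Rightarrow> magma_word \<Rightarrow> nat" where
  "occurrences i (Var j) = (if i = j then 1 else 0)"
| "occurrences i (Prod u v) = occurrences i u + occurrences i v"

text \<open>
  The element \<open>w\<close> is multilinear in \<open>x\<^sub>1, \<dots>, x\<^sub>t\<close>: each of its monomials contains each of these
  variables exactly once, and no other variable.
\<close>

definition multilinear :: "nat \<Rightarrow> ('f::field) free_algebra \<Rightarrow> bool" where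
  "multilinear t w \<longleftrightarrow>
     (\<forall>m\<in>Poly_Mapping.keys w. \<forall>i. occurrences i m = (if i \<in> {1..t} then 1 else 0))"

datatype ideal_kind = Left_Ideal | Right_Ideal | Two_Sided_Ideal | Linear_Subspace

locale nonassoc_algebra = vector_space scale
  for scale :: "'f::field \<Rightarrow> 'a::ab_group_add \<Rightarrow> 'a"
  and mult :: "'a \<Rightarrow> 'a \<Rightarrow> 'a" +
  assumes mult_add_left: "mult (x + y) z = mult x z + mult y z"
    and mult_add_right: "mult z (x + y) = mult z x + mult z y"
    and mult_scale_left: "mult (scale c x) y = scale c (mult x y)"
    and mult_scale_right: "mult x (scale c y) = scale c (mult x y)"
begin

primrec eval_word :: "(nat \<Rightarrow> 'a) \<Rightarrow> magma_word \<Rightarrow> 'a" where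
  "eval_word a (Var i) = a i"
| "eval_word a (Prod u v) = mult (eval_word a u) (eval_word a v)"

definition eval :: "(nat \<Rightarrow> 'a) \<Rightarrow> 'f free_algebra \<Rightarrow> 'a" where
  "eval a w = (\<Sum>m\<in>Poly_Mapping.keys w. scale (Poly_Mapping.lookup w m) (eval_word a m))"

definition satisfies_identity :: "nat \<Rightarrow> 'f free_algebra \<Rightarrow> 'a set \<Rightarrow> bool" where
  "satisfies_identity t w N \<longleftrightarrow> (\<forall>a. (\<forall>i\<in>{1..t}. a i \<in> N) \<longrightarrow> eval a w = 0)"

definition is_ideal :: "ideal_kind \<Rightarrow> 'a set \<Rightarrow> bool" where
  "is_ideal kind I \<longleftrightarrow> subspace I \<and>
     (case kind of
        Left_Ideal \<Rightarrow> (\<forall>a. \<forall>x\<in>I. mult a x \<in> I)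
      | Right_Ideal \<Rightarrow> (\<forall>a. \<forall>x\<in>I. mult x a \<in> I)
      | Two_Sided_Ideal \<Rightarrow> (\<forall>a. \<forall>x\<in>I. mult a x \<in> I \<and> mult x a \<in> I)
      | Linear_Subspace \<Rightarrow> True)"

text \<open>
  Maximality is among all ideals of the given kind that satisfy the identity, of finite
  codimension or not.
\<close>

definition maximal_ideal :: "ideal_kind \<Rightarrow> nat \<Rightarrow> 'f free_algebra \<Rightarrow> 'a set \<Rightarrow> bool" where
  "maximal_ideal kind t w I \<longleftrightarrow> is_ideal kind I \<and> satisfies_identity t w I \<and>
     (\<forall>J. is_ideal kind J \<and> satisfies_identity t w J \<and> I \<subseteq> J \<longrightarrow> J = I)"

text \<open>
  The codimension of a subspace \<open>S\<close> is \<open>k\<close>: some linear complement of \<open>S\<close> has a basis of \<open>k\<close>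
  elements. (The library's \<open>dim\<close> is unsuitable here, being \<open>0\<close> on infinite-dimensional spaces.)
\<close>

definition has_codim :: "'a set \<Rightarrow> nat \<Rightarrow> bool" where
  "has_codim S k \<longleftrightarrow> subspace S \<and>
     (\<exists>B. finite B \<and> card B = k \<and> independent B \<and>
          S \<inter> span B = {0} \<and> (\<forall>x. \<exists>s\<in>S. \<exists>b\<in>span B. x = s + b))"

definition finite_codim :: "'a set \<Rightarrow> bool" where
  "finite_codim S \<longleftrightarrow> (\<exists>k. has_codim S k)"

definition codim_le :: "'a set \<Rightarrow> nat \<Rightarrow> bool" where
  "codim_le S n \<longleftrightarrow> (\<exists>k\<le>n. has_codim S k)"

end

text \<open>
  An explicit number depending only on \<open>n\<close> and \<open>t\<close>. It is explicit because in HOL an existential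
  quantifier in front of a statement about algebras on the type \<open>'a\<close> over the field \<open>'f\<close> would let
  the number depend on these types; a closed function on natural numbers cannot.

  Origin of the recursion: let \<open>K\<^sub>0\<close> be one of the maximal ideals of codimension at most \<open>n\<close> (if
  there are none, the intersection is the whole algebra \<open>A\<close>). Given an ideal \<open>K\<^sub>s\<close> of codimension at
  most \<open>d\<close>, the \<open>(s+1)\<close>-st tensor powers of the images in \<open>A/K\<^sub>s\<close> of the ideals \<open>M\<close> of the family
  span a space of dimension at most \<open>d ^ (s+1)\<close>, so at most \<open>d ^ (s+1)\<close> of the \<open>M\<close> suffice
  to span it; \<open>K\<^sub>s\<^sub>+\<^sub>1\<close> is the intersection of \<open>K\<^sub>s\<close> with these, of codimension at most
  \<open>d + n * d ^ (s+1)\<close>. Inductively, \<open>w\<close> vanishes when at most \<open>s\<close> of its arguments are taken from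
  one \<open>M\<close> and all others from \<open>K\<^sub>s\<close>. Hence, once \<open>s + 1 \<ge> t\<close>, every \<open>M + K\<^sub>s\<close> satisfies the
  identity, and \<open>K\<^sub>s \<subseteq> M\<close> by maximality.
\<close>

primrec codim_bound :: "nat \<Rightarrow> nat \<Rightarrow> nat" where
  "codim_bound n 0 = n"
| "codim_bound n (Suc s) = codim_bound n s + n * codim_bound n s ^ Suc s"

end

theory Submission
  imports Defs "HOL-Library.Function_Algebras" "HOL-Library.FuncSet"
begin

text \<open>
  Let \<open>\<M>\<close> be the family of maximal ideals in question, supposed nonempty. It suffices to find finitely many
  members of \<open>\<M>\<close> with intersection \<open>K\<close> such that \<open>M + K\<close> satisfies the identity for every
  \<open>M \<in> \<M>\<close>: since \<open>M + K\<close> is an ideal containing \<open>M\<close>, maximality gives \<open>K \<subseteq> M\<close>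
  (\<open>maximal_ideal_contains\<close>), so \<open>K\<close> is the whole intersection. Its codimension is at most the sum
  of the codimensions of the chosen members.

  The identity on \<open>M + K\<close> is approached one argument at a time: let \<open>vanishes_up_to t w s M K\<close> say that
  \<open>w\<close> vanishes when at most \<open>s\<close> arguments come from \<open>M\<close> and the others from \<open>K\<close>. A single member
  \<open>K \<in> \<M>\<close> does for \<open>s = 0\<close>. To pass from \<open>s\<close> to \<open>s + 1\<close>, \<open>K\<close> is shrunk to
  \<open>K' = K \<inter> M\<^sub>1 \<inter> \<dots> \<inter> M\<^sub>q\<close> (\<open>vanishes_up_to_step\<close>). Fix \<open>s + 1\<close> positions and put elements of \<open>K'\<close>
  in all others; \<open>w\<close> becomes a multilinear map \<open>g\<close> in \<open>s + 1\<close> arguments. By the property for \<open>s\<close>,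
  \<open>g\<close> is \<open>0\<close> if all its arguments lie in \<open>M + K\<close> and one of them in \<open>K\<close>. So on arguments from \<open>M\<close>
  it depends only on their classes in \<open>A/K\<close>, and linearly on the tensor product of these classes,
  an element of a space of dimension \<open>d ^ (s + 1)\<close>, where \<open>d\<close> is the codimension of \<open>K\<close>.
  If the \<open>M\<^sub>i\<close> are chosen so that the tensors they contribute span all those contributed by \<open>\<M>\<close>, it
  is enough that \<open>g\<close> vanishes on arguments from one \<open>M\<^sub>i\<close>; and it does, because then all arguments
  of \<open>w\<close> lie in \<open>M\<^sub>i\<close>. The choice depends only on \<open>K\<close> and \<open>s\<close>, not on \<open>g\<close>
  (\<open>finite_test_family\<close>), hence serves all positions and all elements of \<open>K'\<close> at once.
\<close>

section \<open>Codimension\<close>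

context nonassoc_algebra
begin

lemma span_Un_subspaceE:
  assumes "x \<in> span (S \<union> B)" "subspace S"
  obtains s b where "s \<in> S" "b \<in> span B" "x = s + b"
  using assms unfolding span_Un span_eq_iff[THEN iffD2, OF assms(2)] by auto

text \<open>
  A spanning set modulo \<open>S\<close> can be thinned out until no element lies in the span of \<open>S\<close> and the
  others; what remains is independent and spans a complement. This is what allows codimension to
  be estimated by exhibiting any finite spanning set.
\<close>

lemma codim_leI:
  assumes "subspace S" "finite B" "span (S \<union> B) = UNIV"
  shows "codim_le S (card B)"
  using assms(2,3)
proof (induction "card B" arbitrary: B rule: less_induct)
  case less
  show ?case
  proof (cases "\<exists>b\<in>B. b \<in> span (S \<union> (B - {b}))")
    case True
    then obtain b where b: "b \<in> B" "b \<in> span (S \<union> (B - {b}))" by blast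
    have "span (S \<union> B) = span (insert b (S \<union> (B - {b})))"
      using b(1) by (intro arg_cong[of _ _ span]) blast
    also have "\<dots> = span (S \<union> (B - {b}))" using b(2) by (rule span_redundant)
    finally have "codim_le S (card (B - {b}))"
      using less.prems card_Diff1_less[OF less.prems(1) b(1)] by (intro less.hyps) auto
    moreover have "card (B - {b}) \<le> card B" by (simp add: card_Diff1_le)
    ultimately show ?thesis unfolding codim_le_def by (meson le_trans)
  next
    case False
    have "independent B"
      unfolding dependent_def using False span_mono[of "B - {b}" "S \<union> (B - {b})" for b] by blast
    moreover have "v = 0" if v: "v \<in> S" "v \<in> span B" for v
    proof -
      obtain r where r: "v = (\<Sum>b\<in>B. scale (r b) b)"
        using v(2) span_finite[OF less.prems(1)] by blast
      have "r b = 0" if b: "b \<in> B" for b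
      proof (rule ccontr)
        assume nz: "r b \<noteq> 0"
        have "v = scale (r b) b + (\<Sum>c\<in>B-{b}. scale (r c) c)"
          unfolding r using less.prems(1) b by (simp add: sum.remove)
        then have "scale (r b) b = v - (\<Sum>c\<in>B-{b}. scale (r c) c)" by simp
        also have "\<dots> \<in> span (S \<union> (B - {b}))"
          using v(1) by (intro span_diff span_sum span_scale) (auto intro: span_base)
        finally have "b \<in> span (S \<union> (B - {b}))" using nz span_scale[of "scale (r b) b" _ "inverse (r b)"] by simp
        with False b show False by blast
      qed
      then show ?thesis unfolding r by (simp add: sum.neutral)
    qed
    then have "S \<inter> span B = {0}" using assms(1) subspace_0 span_zero by blast
    moreover have "\<exists>s\<in>S. \<exists>b\<in>span B. x = s + b" for x
    proof -
      have "x \<in> span (S \<union> B)" using less.prems(2) by simp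
      then show ?thesis using assms(1) by (rule span_Un_subspaceE) blast
    qed
    ultimately show ?thesis
      unfolding codim_le_def has_codim_def using assms(1) less.prems(1) by blast
  qed
qed

lemma codim_leE:
  assumes "codim_le S n"
  obtains B where "subspace S" "finite B" "card B \<le> n" "span (S \<union> B) = UNIV"
proof -
  obtain B where B: "finite B" "card B \<le> n" "subspace S" "\<And>x. \<exists>s\<in>S. \<exists>b\<in>span B. x = s + b"
    using assms unfolding codim_le_def has_codim_def by blast
  then have "span (S \<union> B) = UNIV"
    unfolding span_Un span_eq_iff[THEN iffD2, OF B(3)] by (simp add: set_eq_iff) metis
  then show thesis using that B by blast
qed

lemma codim_le_mono: "codim_le S m \<Longrightarrow> m \<le> n \<Longrightarrow> codim_le S n"
  unfolding codim_le_def by (meson le_trans)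

lemma codim_le_UNIV: "codim_le UNIV n"
  using codim_leI[of UNIV "{}"] codim_le_mono by force

text \<open>
  It is enough to span \<open>S\<close> modulo \<open>T\<close> by at most \<open>n\<close> vectors of \<open>S\<close>. Each \<open>x \<in> S\<close> is congruent
  modulo \<open>T\<close> to some \<open>p x\<close> in the span of \<open>n\<close> vectors. A maximal independent subset of these \<open>p x\<close>
  has at most \<open>n\<close> elements, and preimages of its elements in \<open>S\<close> are the required vectors.
\<close>

lemma codim_le_Int:
  assumes "codim_le S m" "codim_le T n"
  shows "codim_le (S \<inter> T) (m + n)"
proof -
  obtain B where S: "subspace S" and B: "finite B" "card B \<le> m" "span (S \<union> B) = UNIV"
    using assms(1) by (rule codim_leE)
  obtain C where T: "subspace T" and C: "finite C" "card C \<le> n" "span (T \<union> C) = UNIV"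
    using assms(2) by (rule codim_leE)
  have "\<exists>p\<in>span C. x - p \<in> T" for x
  proof -
    have "x \<in> span (T \<union> C)" using C(3) by simp
    then obtain s c where "s \<in> T" "c \<in> span C" "x = s + c" using T by (rule span_Un_subspaceE)
    then show ?thesis by (intro bexI[of _ c]) auto
  qed
  then obtain p where p: "\<And>x. p x \<in> span C" "\<And>x. x - p x \<in> T" by metis
  obtain P where P: "P \<subseteq> p ` S" "independent P" "p ` S \<subseteq> span P"
    using maximal_independent_subset by blast
  have finP: "finite P" and cardP: "card P \<le> n"
    using independent_span_bound[OF C(1) P(2)] P(1) p(1) C(2) by (auto intro: order_trans)
  obtain D where D: "D \<subseteq> S" "inj_on p D" "P = p ` D" using P(1) by (meson subset_image_inj)
  have finD: "finite D" and cardD: "card D \<le> n"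
    using D finP cardP by (auto simp: card_image finite_image_iff)
  let ?U = "span ((S \<inter> T) \<union> (B \<union> D))"
  have pST: "p x \<in> span (T \<union> D)" if "x \<in> S" for x
  proof -
    have "p d \<in> span (T \<union> D)" if "d \<in> D" for d
    proof -
      have "d - (d - p d) \<in> span (T \<union> D)"
        using that p(2) by (intro span_diff span_base) auto
      then show ?thesis by simp
    qed
    then have "span P \<subseteq> span (T \<union> D)" unfolding D(3) by (intro span_minimal) auto
    then show ?thesis using P(3) that by blast
  qed
  have "S \<subseteq> ?U"
  proof
    fix x assume x: "x \<in> S"
    have "(x - p x) + p x \<in> span (T \<union> D)"
      using p(2) by (intro span_add pST x) (auto intro: span_base)
    then have "x \<in> span (T \<union> D)" by simp
    then obtain u d where ud: "u \<in> T" "d \<in> span D" "x = u + d"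
      using T by (rule span_Un_subspaceE)
    have "d \<in> S" using ud(2) D(1) S span_minimal by blast
    then have "u \<in> S" using ud(3) x S by (metis add_diff_cancel_right' subspace_diff)
    then show "x \<in> ?U"
      using ud span_mono[of D "(S \<inter> T) \<union> (B \<union> D)"] by (auto intro!: span_add intro: span_base)
  qed
  then have "span (S \<union> B) \<subseteq> ?U" by (intro span_minimal) (auto intro: span_base)
  then have "?U = UNIV" using B(3) by auto
  then have "codim_le (S \<inter> T) (card (B \<union> D))"
    using S T B(1) finD by (intro codim_leI subspace_inter) auto
  moreover have "card (B \<union> D) \<le> m + n" using card_Un_le[of B D] B(2) cardD by linarith
  ultimately show ?thesis by (rule codim_le_mono)
qed

lemma codim_le_Int_Inter:
  assumes "finite \<M>" "codim_le K d" "\<forall>M\<in>\<M>. codim_le M n"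
  shows "codim_le (K \<inter> \<Inter>\<M>) (d + n * card \<M>)"
  using assms(1,3)
proof (induction rule: finite_induct)
  case empty
  then show ?case using assms(2) by simp
next
  case (insert M \<M>)
  then have "codim_le ((K \<inter> \<Inter>\<M>) \<inter> M) ((d + n * card \<M>) + n)"
    by (auto intro: codim_le_Int)
  moreover have "K \<inter> \<Inter>\<M> \<inter> M = K \<inter> \<Inter>(insert M \<M>)" by auto
  ultimately show ?case using insert.hyps by (simp add: add.assoc add.commute[of n] del: Inter_insert)
qed

end

section \<open>Families of multilinear maps tested on finitely many subspaces\<close>

interpretation fun_space: vector_space "\<lambda>c (f :: 'x \<Rightarrow> 'f::field) x. c * f x"
  by unfold_locales (auto simp: fun_eq_iff algebra_simps)

lemma sum_apply: "(\<Sum>i\<in>I. f i) x = (\<Sum>i\<in>I. f i x)"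
  by (induction I rule: infinite_finite_induct) auto

text \<open>
  The elements of \<open>X\<close> are coefficient vectors supported in \<open>I\<close>, so a maximal independent subset \<open>X0\<close>
  has at most \<open>card I\<close> elements, and a linear combination with these coefficients that vanishes
  on \<open>X0\<close> vanishes on its span. The vectors \<open>h\<close> come after \<open>X0\<close>, which is therefore a test set
  for all of them simultaneously.
\<close>

lemma (in vector_space) finite_test_set:
  fixes X :: "('x \<Rightarrow> 'a) set"
  assumes "finite I" "\<forall>x\<in>X. \<forall>i. i \<notin> I \<longrightarrow> x i = 0"
  obtains X0 where "X0 \<subseteq> X" "finite X0" "card X0 \<le> card I"
    "\<And>h x. \<lbrakk>\<forall>y\<in>X0. (\<Sum>i\<in>I. scale (y i) (h i)) = 0; x \<in> X\<rbrakk> \<Longrightarrow> (\<Sum>i\<in>I. scale (x i) (h i)) = 0"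
proof -
  define e :: "'x \<Rightarrow> 'x \<Rightarrow> 'a" where "e = (\<lambda>i j. if i = j then 1 else 0)"
  obtain X0 where X0: "X0 \<subseteq> X" "fun_space.independent X0" "X \<subseteq> fun_space.span X0"
    using fun_space.maximal_independent_subset by blast
  have "x \<in> fun_space.span (e ` I)" if "x \<in> X" for x
  proof -
    have "x j = (\<Sum>i\<in>I. x i * e i j)" for j
    proof -
      have "(\<Sum>i\<in>I. x i * e i j) = (\<Sum>i\<in>I. if i = j then x i else 0)"
        unfolding e_def by (intro sum.cong) auto
      then show ?thesis using assms that by (simp add: sum.delta)
    qed
    then have "x = (\<Sum>i\<in>I. (\<lambda>j. x i * e i j))"
      by (intro ext) (subst sum_apply, assumption)
    also have "\<dots> \<in> fun_space.span (e ` I)"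
      by (intro fun_space.span_sum fun_space.span_scale fun_space.span_base) auto
    finally show ?thesis .
  qed
  then have "finite X0 \<and> card X0 \<le> card (e ` I)"
    using X0(1) assms(1) by (intro fun_space.independent_span_bound[OF _ X0(2)]) auto
  then have "finite X0" "card X0 \<le> card I"
    using card_image_le[OF assms(1), of e] by auto
  moreover have "(\<Sum>i\<in>I. scale (x i) (h i)) = 0"
    if 0: "\<forall>y\<in>X0. (\<Sum>i\<in>I. scale (y i) (h i)) = 0" and x: "x \<in> X" for h x
  proof -
    have "fun_space.subspace {y. (\<Sum>i\<in>I. scale (y i) (h i)) = 0}"
      unfolding fun_space.subspace_def
      by (auto simp: scale_left_distrib sum.distrib scale_scale[symmetric] scale_sum_right[symmetric]
          simp del: scale_scale)
    then have "fun_space.span X0 \<subseteq> {y. (\<Sum>i\<in>I. scale (y i) (h i)) = 0}"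
      using 0 by (intro fun_space.span_minimal) auto
    then show ?thesis using x X0(3) by blast
  qed
  ultimately show thesis using that X0(1) by blast
qed

context nonassoc_algebra
begin

definition multilinear_on :: "'i set \<Rightarrow> (('i \<Rightarrow> 'a) \<Rightarrow> 'a) \<Rightarrow> bool" where
  "multilinear_on S g \<longleftrightarrow> (\<forall>i\<in>S. \<forall>a. Vector_Spaces.linear scale scale (\<lambda>x. g (a(i := x))))"

lemma multilinear_on_expand:
  assumes "finite S" "multilinear_on S g" "\<forall>i\<in>S. a i = (\<Sum>b\<in>B. scale (r i b) b)"
  shows "g a = (\<Sum>\<phi>\<in>S \<rightarrow>\<^sub>E B. scale (\<Prod>i\<in>S. r i (\<phi> i)) (g (override_on a \<phi> S)))"
  using assms
proof (induction S arbitrary: a rule: finite_induct)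
  case empty
  then show ?case by simp
next
  case (insert j S)
  let ?term = "\<lambda>S \<phi>. scale (\<Prod>i\<in>S. r i (\<phi> i)) (g (override_on a \<phi> S))"
  interpret lin: Vector_Spaces.linear scale scale "\<lambda>x. g (a(j := x))"
    using insert.prems by (simp add: multilinear_on_def)
  have "g a = g (a(j := \<Sum>b\<in>B. scale (r j b) b))"
    using insert.prems by (metis fun_upd_triv insertI1)
  also have "\<dots> = (\<Sum>b\<in>B. scale (r j b) (g (a(j := b))))"
    by (simp add: lin.sum lin.scale)
  also have "\<dots> = (\<Sum>b\<in>B. \<Sum>\<phi>\<in>S \<rightarrow>\<^sub>E B. ?term (insert j S) (\<phi>(j := b)))"
  proof (rule sum.cong[OF refl])
    fix b assume "b \<in> B"
    have "g (a(j := b)) = (\<Sum>\<phi>\<in>S \<rightarrow>\<^sub>E B. scale (\<Prod>i\<in>S. r i (\<phi> i)) (g (override_on (a(j := b)) \<phi> S)))"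
      using insert.prems insert.hyps by (intro insert.IH) (auto simp: multilinear_on_def)
    moreover have "override_on (a(j := b)) \<phi> S = override_on a (\<phi>(j := b)) (insert j S)" for \<phi>
      using insert.hyps by (auto simp: override_on_def)
    moreover have "(\<Prod>i\<in>insert j S. r i ((\<phi>(j := b)) i)) = r j b * (\<Prod>i\<in>S. r i (\<phi> i))" for \<phi>
      using insert.hyps by (simp, intro disjI2 prod.cong) auto
    ultimately show "scale (r j b) (g (a(j := b))) = (\<Sum>\<phi>\<in>S \<rightarrow>\<^sub>E B. ?term (insert j S) (\<phi>(j := b)))"
      by (simp add: scale_sum_right)
  qed
  also have "\<dots> = (\<Sum>(b, \<phi>)\<in>B \<times> (S \<rightarrow>\<^sub>E B). ?term (insert j S) (\<phi>(j := b)))"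
    by (rule sum.cartesian_product)
  also have "\<dots> = (\<Sum>\<phi>\<in>insert j S \<rightarrow>\<^sub>E B. ?term (insert j S) \<phi>)"
    unfolding PiE_insert_eq
    by (subst sum.reindex[OF inj_combinator[OF insert.hyps(2)]]) (simp add: case_prod_unfold)
  finally show ?case .
qed

lemma multilinear_on_add:
  assumes "multilinear_on S g" "i \<in> S" "a i = x + y"
  shows "g a = g (a(i := x)) + g (a(i := y))"
proof -
  interpret lin: Vector_Spaces.linear scale scale "\<lambda>z. g (a(i := z))"
    using assms(1,2) by (simp add: multilinear_on_def)
  show ?thesis using lin.add[of x y] assms(3) by (metis fun_upd_triv)
qed

text \<open>
  Exchanging arguments one at a time: the error at each exchange is a value of \<open>g\<close> with one argument
  in \<open>K\<close> and all of them in \<open>N\<close>. Since \<open>g\<close> is only known to vanish on such tuples, the intermediate ones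
  must stay inside \<open>N\<close>; this is why both \<open>a\<close> and \<open>b\<close> are required to lie there.
\<close>

lemma multilinear_on_cong_mod:
  assumes g: "multilinear_on S g" and S: "finite S" and N: "subspace N"
    and 0: "\<And>c j. \<lbrakk>\<forall>i\<in>S. c i \<in> N; j \<in> S; c j \<in> K\<rbrakk> \<Longrightarrow> g c = 0"
    and ab: "\<forall>i\<in>S. a i \<in> N" "\<forall>i\<in>S. b i \<in> N" "\<forall>i\<in>S. a i - b i \<in> K"
  shows "g (override_on a b S) = g a"
proof -
  have "g (override_on a b T) = g a" if "finite T" "T \<subseteq> S" for T
    using that
  proof (induction T rule: finite_induct)
    case empty
    then show ?case by simp
  next
    case (insert j T)
    let ?c = "override_on a b T"
    have c: "\<forall>i\<in>S. ?c i \<in> N" using ab by (auto simp: override_on_def)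
    have "g ?c = g (?c(j := b j)) + g (?c(j := a j - b j))"
      using insert by (intro multilinear_on_add[OF g]) (auto simp: override_on_def)
    moreover have "g (?c(j := a j - b j)) = 0"
      using insert.prems ab c by (intro 0[of _ j]) (auto intro: subspace_diff[OF N])
    moreover have "?c(j := b j) = override_on a b (insert j T)"
      by (auto simp: override_on_def)
    ultimately show ?case using insert by simp
  qed
  with S show ?thesis by blast
qed

text \<open>
  Tensors of classes modulo \<open>K\<close> are represented by their coordinates: \<open>B\<close> spans modulo \<open>K\<close>, each
  \<open>x\<close> is congruent to a combination \<open>p x\<close> of \<open>B\<close> with coefficients \<open>r x\<close>, and the tensor of
  \<open>c 0, \<dots>, c (m - 1)\<close> becomes the function sending \<open>\<phi>\<close> to the product of the \<open>r (c i) (\<phi> i)\<close>,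
  with one coordinate for each \<open>\<phi>\<close> from \<open>{..<m}\<close> to \<open>B\<close>. Any choice of the
  coefficients will do, because only the congruence of \<open>x\<close> and \<open>p x\<close> enters. Replacing \<open>c i\<close> by \<open>p (c i)\<close> leaves \<open>M\<close> but not
  \<open>M + K\<close>, so the vanishing of \<open>g\<close> modulo \<open>K\<close> is needed on tuples from \<open>M + K\<close>, here written as
  \<open>span (M \<union> K)\<close>.
\<close>

lemma finite_test_family:
  fixes \<M> :: "'a set set" and K :: "'a set" and m :: nat
  assumes K: "subspace K" and B: "finite B" "span (K \<union> B) = UNIV"
  obtains \<M>\<^sub>0 where "\<M>\<^sub>0 \<subseteq> \<M>" "finite \<M>\<^sub>0" "card \<M>\<^sub>0 \<le> card B ^ m"
    "\<And>g. \<lbrakk>multilinear_on {..<m} g; \<And>c c'. \<forall>i<m. c i = c' i \<Longrightarrow> g c = g c';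
        \<And>M c j. \<lbrakk>M \<in> \<M>; \<forall>i<m. c i \<in> span (M \<union> K); j < m; c j \<in> K\<rbrakk> \<Longrightarrow> g c = 0;
        \<And>M c. \<lbrakk>M \<in> \<M>\<^sub>0; \<forall>i<m. c i \<in> M\<rbrakk> \<Longrightarrow> g c = 0\<rbrakk>
      \<Longrightarrow> \<forall>M\<in>\<M>. \<forall>c. (\<forall>i<m. c i \<in> M) \<longrightarrow> g c = 0"
proof -
  have "\<exists>r. x - (\<Sum>b\<in>B. scale (r b) b) \<in> K" for x
  proof -
    have "x \<in> span (K \<union> B)" using B(2) by simp
    then obtain s y where "s \<in> K" "y \<in> span B" "x = s + y" using K by (rule span_Un_subspaceE)
    then obtain u where "y = (\<Sum>v\<in>B. scale (u v) v)" unfolding span_finite[OF B(1)] by blast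
    then have "x - (\<Sum>b\<in>B. scale (u b) b) \<in> K" using \<open>s \<in> K\<close> \<open>x = s + y\<close> by simp
    then show ?thesis by blast
  qed
  then obtain r where r: "\<And>x. x - (\<Sum>b\<in>B. scale (r x b) b) \<in> K" by metis
  define p where "p x = (\<Sum>b\<in>B. scale (r x b) b)" for x
  define \<Phi> where "\<Phi> = ({..<m} \<rightarrow>\<^sub>E B)"
  define tensor where "tensor c \<phi> = (if \<phi> \<in> \<Phi> then \<Prod>i<m. r (c i) (\<phi> i) else 0)"
    for c :: "nat \<Rightarrow> 'a" and \<phi>
  have \<Phi>: "finite \<Phi>" "card \<Phi> = card B ^ m"
    unfolding \<Phi>_def using B(1) by (auto simp: card_funcsetE intro: finite_PiE)
  define X where "X = {tensor c | M c. M \<in> \<M> \<and> (\<forall>i<m. c i \<in> M)}"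
  have supp: "\<forall>x\<in>X. \<forall>\<phi>. \<phi> \<notin> \<Phi> \<longrightarrow> x \<phi> = 0" by (auto simp: X_def tensor_def)
  obtain X0 where X0: "X0 \<subseteq> X" "finite X0" "card X0 \<le> card \<Phi>"
    "\<And>h x. \<lbrakk>\<forall>y\<in>X0. (\<Sum>\<phi>\<in>\<Phi>. scale (y \<phi>) (h \<phi>)) = 0; x \<in> X\<rbrakk>
      \<Longrightarrow> (\<Sum>\<phi>\<in>\<Phi>. scale (x \<phi>) (h \<phi>)) = 0"
  proof (rule finite_test_set[OF \<Phi>(1) supp], goal_cases)
    case (1 X0)
    show ?case by (rule 1(1)[OF 1(2-4)]) (rule 1(5))
  qed
  have "\<forall>x\<in>X0. \<exists>M c. M \<in> \<M> \<and> (\<forall>i<m. c i \<in> M) \<and> x = tensor c"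
    using X0(1) unfolding X_def by blast
  then obtain \<mu> where \<mu>: "\<And>x. x \<in> X0 \<Longrightarrow> \<mu> x \<in> \<M> \<and> (\<exists>c. (\<forall>i<m. c i \<in> \<mu> x) \<and> x = tensor c)"
    by metis
  \<comment> \<open>Each tensor of the test set is contributed by some member of \<open>\<M>\<close>; these members suffice.\<close>
  show thesis
  proof (rule that[of "\<mu> ` X0"])
    show "\<mu> ` X0 \<subseteq> \<M>" using \<mu> by auto
    show "finite (\<mu> ` X0)" using X0(2) by simp
    show "card (\<mu> ` X0) \<le> card B ^ m"
      using card_image_le[OF X0(2), of \<mu>] X0(3) \<Phi>(2) by linarith
    fix g :: "(nat \<Rightarrow> 'a) \<Rightarrow> 'a"
    assume g: "multilinear_on {..<m} g" and gcong: "\<And>c c'. \<forall>i<m. c i = c' i \<Longrightarrow> g c = g c'"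
      and g0: "\<And>M c j. \<lbrakk>M \<in> \<M>; \<forall>i<m. c i \<in> span (M \<union> K); j < m; c j \<in> K\<rbrakk> \<Longrightarrow> g c = 0"
      and g1: "\<And>M c. \<lbrakk>M \<in> \<mu> ` X0; \<forall>i<m. c i \<in> M\<rbrakk> \<Longrightarrow> g c = 0"
    have pM: "p x \<in> span (M \<union> K)" if "x \<in> M" for x M
    proof -
      have "x - (x - p x) \<in> span (M \<union> K)"
        using r[of x] that unfolding p_def by (intro span_diff span_base) auto
      then show ?thesis by simp
    qed
    have key: "g c = (\<Sum>\<phi>\<in>\<Phi>. scale (tensor c \<phi>) (g \<phi>))"
      if "M \<in> \<M>" "\<forall>i<m. c i \<in> M" for M c
    proof -
      let ?p = "\<lambda>i. p (c i)"
      have "g c = g (override_on c ?p {..<m})"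
      proof (rule multilinear_on_cong_mod[symmetric, where N = "span (M \<union> K)" and K = K])
        show "g c' = 0" if "\<forall>i\<in>{..<m}. c' i \<in> span (M \<union> K)" "j \<in> {..<m}" "c' j \<in> K" for c' j
          using that by (intro g0[OF \<open>M \<in> \<M>\<close>, of c' j]) simp_all
        show "\<forall>i\<in>{..<m}. c i \<in> span (M \<union> K)" using that(2) span_base by blast
        show "\<forall>i\<in>{..<m}. p (c i) \<in> span (M \<union> K)" using that(2) pM by blast
        show "\<forall>i\<in>{..<m}. c i - p (c i) \<in> K" unfolding p_def using r by blast
      qed (use g in simp_all)
      also have "\<dots> = (\<Sum>\<phi>\<in>\<Phi>. scale (\<Prod>i<m. r (c i) (\<phi> i))
          (g (override_on (override_on c ?p {..<m}) \<phi> {..<m})))"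
        unfolding \<Phi>_def by (rule multilinear_on_expand[OF finite_lessThan g]) (simp add: p_def)
      also have "\<dots> = (\<Sum>\<phi>\<in>\<Phi>. scale (tensor c \<phi>) (g \<phi>))"
      proof (rule sum.cong[OF refl])
        fix \<phi> assume "\<phi> \<in> \<Phi>"
        moreover have "g (override_on (override_on c ?p {..<m}) \<phi> {..<m}) = g \<phi>"
          by (intro gcong) (auto simp: override_on_def)
        ultimately show "scale (\<Prod>i<m. r (c i) (\<phi> i))
            (g (override_on (override_on c ?p {..<m}) \<phi> {..<m})) = scale (tensor c \<phi>) (g \<phi>)"
          by (simp add: tensor_def)
      qed
      finally show ?thesis .
    qed
    have "(\<Sum>\<phi>\<in>\<Phi>. scale (x \<phi>) (g \<phi>)) = 0" if x: "x \<in> X0" for x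
    proof -
      obtain c where c: "\<forall>i<m. c i \<in> \<mu> x" "x = tensor c" using \<mu>[OF x] by blast
      then have "g c = 0" using x by (intro g1) auto
      then show ?thesis using key[of "\<mu> x" c] \<mu>[OF x] c by simp
    qed
    then have "(\<Sum>\<phi>\<in>\<Phi>. scale (x \<phi>) (g \<phi>)) = 0" if "x \<in> X" for x
      using X0(4) that by blast
    moreover have "tensor c \<in> X" if "M \<in> \<M>" "\<forall>i<m. c i \<in> M" for M c
      unfolding X_def using that by blast
    ultimately show "\<forall>M\<in>\<M>. \<forall>c. (\<forall>i<m. c i \<in> M) \<longrightarrow> g c = 0"
      using key by metis
  qed
qed


section \<open>Evaluation of a multilinear element\<close>

lemma eval_word_cong:
  "\<forall>i. 0 < occurrences i u \<longrightarrow> a i = b i \<Longrightarrow> eval_word a u = eval_word b u"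
proof (induction u)
  case (Prod u v)
  then show ?case by (metis add_gr_0 eval_word.simps(2) occurrences.simps(2))
qed auto

lemma linear_eval_word:
  assumes "occurrences i u = 1"
  shows "Vector_Spaces.linear scale scale (\<lambda>x. eval_word (a(i := x)) u)"
  using assms
proof (induction u)
  case (Var j)
  then show ?case using linear_id by (simp add: id_def split: if_splits)
next
  case (Prod u v)
  have const: "eval_word (a(i := x)) u = eval_word a u" if "occurrences i u = 0" for u x
    using that by (intro eval_word_cong) auto
  consider "occurrences i u = 1" "occurrences i v = 0" | "occurrences i u = 0" "occurrences i v = 1"
    using Prod.prems by (metis add_is_1 occurrences.simps(2) One_nat_def)
  then show ?case
  proof cases
    case 1
    then interpret lin: Vector_Spaces.linear scale scale "\<lambda>x. eval_word (a(i := x)) u"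
      using Prod.IH(1) by blast
    show ?thesis using 1
      by unfold_locales (simp_all only: eval_word.simps const lin.add lin.scale mult_add_left mult_scale_left)
  next
    case 2
    then interpret lin: Vector_Spaces.linear scale scale "\<lambda>x. eval_word (a(i := x)) v"
      using Prod.IH(2) by blast
    show ?thesis using 2
      by unfold_locales (simp_all only: eval_word.simps const lin.add lin.scale mult_add_right mult_scale_right)
  qed
qed

lemma multilinear_on_eval:
  assumes "multilinear t w"
  shows "multilinear_on {1..t} (\<lambda>a. eval a w)"
  unfolding multilinear_on_def
proof (intro ballI allI)
  fix i a assume "i \<in> {1..t}"
  then have hom: "module_hom scale scale (\<lambda>x. eval_word (a(i := x)) u)"
    if "u \<in> Poly_Mapping.keys w" for u
    using assms that by (intro linear_eval_word[unfolded linear_iff_module_hom]) (auto simp: multilinear_def)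
  have add: "eval_word (a(i := x + y)) u = eval_word (a(i := x)) u + eval_word (a(i := y)) u"
    and scl: "eval_word (a(i := scale c x)) u = scale c (eval_word (a(i := x)) u)"
    if "u \<in> Poly_Mapping.keys w" for u x y c
    using module_hom.add[OF hom[OF that]] module_hom.scale[OF hom[OF that]] by simp_all
  show "Vector_Spaces.linear scale scale (\<lambda>x. eval (a(i := x)) w)"
    unfolding eval_def
    by unfold_locales
      (simp_all add: add scl scale_right_distrib sum.distrib scale_sum_right mult.commute cong: sum.cong)
qed

section \<open>Shrinking the intersection\<close>

definition vanishes_up_to :: "nat \<Rightarrow> 'f free_algebra \<Rightarrow> nat \<Rightarrow> 'a set \<Rightarrow> 'a set \<Rightarrow> bool" where
  "vanishes_up_to t w s M K \<longleftrightarrow> (\<forall>S a. S \<subseteq> {1..t} \<and> card S \<le> s \<and> (\<forall>i\<in>S. a i \<in> M) \<and>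
     (\<forall>i\<in>{1..t} - S. a i \<in> K) \<longrightarrow> eval a w = 0)"

text \<open>
  Writing an argument \<open>a j \<in> M + K\<close> as \<open>x + y\<close> splits the value in two: the term with \<open>x\<close> has one
  mixed argument less, and in the term with \<open>y\<close> the position \<open>j\<close> leaves \<open>S\<close>. The bound is on the
  size of \<open>S\<close> from above, so the latter term is covered too.
\<close>

lemma vanishes_up_to_span:
  assumes w: "multilinear t w" and MK: "subspace M" "subspace K" and van: "vanishes_up_to t w s M K"
    and S: "S \<subseteq> {1..t}" "card S \<le> s"
    and a: "\<forall>i\<in>S. a i \<in> span (M \<union> K)" "\<forall>i\<in>{1..t} - S. a i \<in> K"
  shows "eval a w = 0"
proof -
  have "eval a w = 0"
    if "finite T" "T \<subseteq> S" "S \<subseteq> {1..t}" "card S \<le> s" "\<forall>i\<in>T. a i \<in> span (M \<union> K)"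
      "\<forall>i\<in>S - T. a i \<in> M" "\<forall>i\<in>{1..t} - S. a i \<in> K" for T S a
    using that
  proof (induction T arbitrary: S a rule: finite_induct)
    case empty
    then show ?case using van[unfolded vanishes_up_to_def, rule_format, of S a] by simp
  next
    case (insert j T)
    have finS: "finite S" using finite_subset[OF insert.prems(2)] by simp
    obtain x y where xy: "x \<in> M" "y \<in> K" "a j = x + y"
    proof -
      have "a j \<in> span (M \<union> K)" using insert.prems by blast
      then show ?thesis using MK(1)
        by (rule span_Un_subspaceE) (use that MK(2) span_eq_iff in blast)
    qed
    have "eval a w = eval (a(j := x)) w + eval (a(j := y)) w"
      using insert.prems xy by (intro multilinear_on_add[OF multilinear_on_eval[OF w]]) auto
    moreover have "eval (a(j := x)) w = 0"
      using insert.prems insert.hyps xy by (intro insert.IH[of S]) auto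
    moreover have "eval (a(j := y)) w = 0"
      using insert.prems insert.hyps xy finS card_Diff1_le[of S j]
      by (intro insert.IH[of "S - {j}"]) auto
    ultimately show ?case by simp
  qed
  from this[of S S a] show ?thesis using S a finite_subset[OF S(1)] by simp
qed

text \<open>
  The maps \<open>g\<close> to be tested arise by fixing the arguments of \<open>w\<close> outside a set \<open>S\<close> of \<open>s + 1\<close> positions.
  Renumbering \<open>S\<close> as \<open>{..<Suc s}\<close> makes one choice of test family serve every \<open>S\<close>.
\<close>

lemma vanishes_up_to_step:
  assumes w: "multilinear t w"
    and \<M>: "\<forall>M\<in>\<M>. subspace M \<and> satisfies_identity t w M"
    and K: "subspace K" "\<forall>M\<in>\<M>. vanishes_up_to t w s M K" "codim_le K d"
  obtains \<M>\<^sub>0 where "\<M>\<^sub>0 \<subseteq> \<M>" "finite \<M>\<^sub>0" "card \<M>\<^sub>0 \<le> d ^ Suc s"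
    "\<forall>M\<in>\<M>. vanishes_up_to t w (Suc s) M (K \<inter> \<Inter>\<M>\<^sub>0)"
proof -
  obtain B where B: "finite B" "card B \<le> d" "span (K \<union> B) = UNIV"
    using K(3) by (rule codim_leE)
  obtain \<M>\<^sub>0 where \<M>\<^sub>0: "\<M>\<^sub>0 \<subseteq> \<M>" "finite \<M>\<^sub>0" "card \<M>\<^sub>0 \<le> card B ^ Suc s"
    and test: "\<And>g. \<lbrakk>multilinear_on {..<Suc s} g; \<And>c c'. \<forall>i<Suc s. c i = c' i \<Longrightarrow> g c = g c';
        \<And>M c j. \<lbrakk>M \<in> \<M>; \<forall>i<Suc s. c i \<in> span (M \<union> K); j < Suc s; c j \<in> K\<rbrakk> \<Longrightarrow> g c = 0;
        \<And>M c. \<lbrakk>M \<in> \<M>\<^sub>0; \<forall>i<Suc s. c i \<in> M\<rbrakk> \<Longrightarrow> g c = 0\<rbrakk>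
      \<Longrightarrow> \<forall>M\<in>\<M>. \<forall>c. (\<forall>i<Suc s. c i \<in> M) \<longrightarrow> g c = 0"
  proof (rule finite_test_family[OF K(1) B(1,3), of \<M> "Suc s"], goal_cases)
    case (1 \<M>\<^sub>0)
    show ?case by (rule 1(1)[OF 1(2-4)]) (fact 1(5))
  qed
  have "eval a w = 0"
    if M: "M \<in> \<M>" and S: "S \<subseteq> {1..t}" "card S \<le> Suc s" and a: "\<forall>i\<in>S. a i \<in> M"
      "\<forall>i\<in>{1..t} - S. a i \<in> K \<inter> \<Inter>\<M>\<^sub>0" for M S a
  proof (cases "card S \<le> s")
    case True
    then show ?thesis using K(2) M S a unfolding vanishes_up_to_def by blast
  next
    case False
    have finS: "finite S" using finite_subset[OF S(1)] by simp
    have cS: "card S = Suc s" using False S(2) by linarith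
    obtain f where f: "bij_betw f S {..<Suc s}"
      using ex_bij_betw_finite_nat[OF finS] cS by (auto simp: atLeast0LessThan)
    define e where "e c i = (if i \<in> S then c (f i) else a i)" for c :: "nat \<Rightarrow> 'a" and i
    define g where "g c = eval (e c) w" for c
    have fS: "f i < Suc s" if "i \<in> S" for i using f that by (auto simp: bij_betw_def)
    have e_upd: "\<exists>i\<in>S. f i = j \<and> (\<forall>c x. e (c(j := x)) = (e c)(i := x))" if j: "j < Suc s" for j
    proof -
      have "j \<in> f ` S" using f j by (simp add: bij_betw_def)
      then obtain i where i: "i \<in> S" "f i = j" by blast
      have "e (c(j := x)) = (e c)(i := x)" for c x
        using i f by (auto simp: e_def fun_eq_iff bij_betw_def inj_on_def)
      with i show ?thesis by blast
    qed
    have "multilinear_on {..<Suc s} g"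
      unfolding multilinear_on_def
    proof (intro ballI allI)
      fix j c assume "j \<in> {..<Suc s}"
      then obtain i where "i \<in> S" "\<And>x. e (c(j := x)) = (e c)(i := x)" using e_upd by blast
      then show "Vector_Spaces.linear scale scale (\<lambda>x. g (c(j := x)))"
        using multilinear_on_eval[OF w] S(1) by (auto simp: g_def multilinear_on_def)
    qed
    moreover have "g c = g c'" if "\<forall>i<Suc s. c i = c' i" for c c'
    proof -
      have "e c = e c'" using that fS by (auto simp: e_def fun_eq_iff)
      then show ?thesis by (simp add: g_def)
    qed
    moreover have "g c = 0"
      if M': "M' \<in> \<M>" and c: "\<forall>i<Suc s. c i \<in> span (M' \<union> K)" "j < Suc s" "c j \<in> K" for M' c j
    proof -
      obtain i where i: "i \<in> S" "f i = j" using e_upd[OF c(2)] by blast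
      have "card (S - {i}) \<le> s" using i finS cS by simp
      moreover have "\<forall>l\<in>S - {i}. e c l \<in> span (M' \<union> K)" using c fS by (auto simp: e_def)
      moreover have "\<forall>l\<in>{1..t} - (S - {i}). e c l \<in> K" using c i a by (auto simp: e_def)
      ultimately show ?thesis
        unfolding g_def using M' \<M> K S by (intro vanishes_up_to_span[OF w, of M' K s "S - {i}"]) auto
    qed
    moreover have "g c = 0" if M': "M' \<in> \<M>\<^sub>0" and c: "\<forall>i<Suc s. c i \<in> M'" for M' c
    proof -
      have "\<forall>i\<in>{1..t}. e c i \<in> M'" using a c fS M' by (auto simp: e_def)
      then show ?thesis
        using \<M> M' \<M>\<^sub>0(1) unfolding g_def satisfies_identity_def by blast
    qed
    ultimately have g0: "\<forall>M\<in>\<M>. \<forall>c. (\<forall>i<Suc s. c i \<in> M) \<longrightarrow> g c = 0"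
      by (rule test)
    define c where "c j = a (inv_into S f j)" for j
    have "e c = a" using f by (auto simp: e_def c_def fun_eq_iff bij_betw_def)
    moreover have "c j \<in> M" if "j < Suc s" for j
    proof -
      have "inv_into S f j \<in> S" using f that by (intro inv_into_into) (auto simp: bij_betw_def)
      then show ?thesis using a by (simp add: c_def)
    qed
    ultimately show ?thesis using g0 M by (metis g_def)
  qed
  then have "\<forall>M\<in>\<M>. vanishes_up_to t w (Suc s) M (K \<inter> \<Inter>\<M>\<^sub>0)"
    unfolding vanishes_up_to_def by blast
  moreover have "card \<M>\<^sub>0 \<le> d ^ Suc s"
    using \<M>\<^sub>0(3) power_mono[OF B(2), of "Suc s"] by simp
  ultimately show thesis using that \<M>\<^sub>0(1,2) by blast
qed

section \<open>Ideals and maximality\<close>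

lemma is_ideal_subspace: "is_ideal kind I \<Longrightarrow> subspace I"
  by (simp add: is_ideal_def)

lemma is_ideal_Inter: "\<forall>I\<in>\<M>. is_ideal kind I \<Longrightarrow> is_ideal kind (\<Inter>\<M>)"
  by (cases kind) (auto simp: is_ideal_def intro!: subspace_Inter)

lemma is_ideal_span_Un:
  assumes "is_ideal kind I" "is_ideal kind J"
  shows "is_ideal kind (span (I \<union> J))"
proof -
  have left: "mult a x \<in> span (I \<union> J)"
    if "\<forall>y\<in>I. mult a y \<in> I" "\<forall>y\<in>J. mult a y \<in> J" "x \<in> span (I \<union> J)" for a x
    using that(3)
  proof (induction rule: span_induct_alt)
    case base
    show ?case using mult_scale_right[of a 0 0] by (simp add: span_zero)
  next
    case (step c x y)
    then show ?case using that(1,2)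
      by (auto simp: mult_add_right mult_scale_right intro!: span_add span_scale intro: span_base)
  qed
  have right: "mult x a \<in> span (I \<union> J)"
    if "\<forall>y\<in>I. mult y a \<in> I" "\<forall>y\<in>J. mult y a \<in> J" "x \<in> span (I \<union> J)" for a x
    using that(3)
  proof (induction rule: span_induct_alt)
    case base
    show ?case using mult_scale_left[of 0 0 a] by (simp add: span_zero)
  next
    case (step c x y)
    then show ?case using that(1,2)
      by (auto simp: mult_add_left mult_scale_left intro!: span_add span_scale intro: span_base)
  qed
  show ?thesis
    using assms left right by (cases kind) (simp_all add: is_ideal_def)
qed

lemma maximal_ideal_contains:
  assumes w: "multilinear t w" and M: "maximal_ideal kind t w M" and K: "is_ideal kind K"
    and van: "vanishes_up_to t w t M K"
  shows "K \<subseteq> M"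
proof -
  have M': "is_ideal kind M" using M by (simp add: maximal_ideal_def)
  have "satisfies_identity t w (span (M \<union> K))"
    unfolding satisfies_identity_def
    using vanishes_up_to_span[OF w _ _ van, of "{1..t}"] M' K is_ideal_subspace by auto
  moreover have "is_ideal kind (span (M \<union> K))" using M' K by (rule is_ideal_span_Un)
  moreover have "M \<subseteq> span (M \<union> K)" by (auto intro: span_base)
  ultimately have "span (M \<union> K) = M" using M unfolding maximal_ideal_def by blast
  then show ?thesis by (auto intro: span_base)
qed


lemma finite_codim_iff: "finite_codim S \<longleftrightarrow> (\<exists>n. codim_le S n)"
  unfolding finite_codim_def codim_le_def by blast

lemma finite_codim_Inter:
  assumes "finite \<M>" "\<forall>M\<in>\<M>. finite_codim M"
  shows "finite_codim (\<Inter>\<M>)"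
  using assms
proof (induction rule: finite_induct)
  case empty
  then show ?case using codim_le_UNIV finite_codim_iff by auto
next
  case (insert M \<M>)
  then show ?case unfolding finite_codim_iff by (auto intro: codim_le_Int)
qed

text \<open>
  The recursion of \<open>codim_bound\<close> accompanies the induction. The subfamily must not depend on \<open>n\<close>, as
  the case where codimensions are finite but unbounded has no \<open>n\<close>; therefore the test family is chosen
  for the least codimension \<open>d\<close> of the current intersection, which lies below every bound.
\<close>

lemma vanishes_up_to_finite_Inter:
  assumes w: "multilinear t w"
    and \<M>: "\<forall>M\<in>\<M>. subspace M \<and> satisfies_identity t w M \<and> finite_codim M" "\<M> \<noteq> {}"
  shows "\<exists>\<N>\<subseteq>\<M>. finite \<N> \<and> (\<forall>M\<in>\<M>. vanishes_up_to t w s M (\<Inter>\<N>)) \<and>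
    (\<forall>n. (\<forall>M\<in>\<M>. codim_le M n) \<longrightarrow> codim_le (\<Inter>\<N>) (codim_bound n s))"
proof (induction s)
  case 0
  obtain M0 where M0: "M0 \<in> \<M>" using \<M>(2) by blast
  have "vanishes_up_to t w 0 M M0" for M
    unfolding vanishes_up_to_def
  proof (intro allI impI, elim conjE)
    fix S a assume S: "S \<subseteq> {1..t}" "card S \<le> 0" and a: "\<forall>i\<in>{1..t} - S. a i \<in> M0"
    have "S = {}" using finite_subset[OF S(1)] S(2) by simp
    then show "eval a w = 0" using a \<M>(1) M0 unfolding satisfies_identity_def by auto
  qed
  then show ?case using M0 by (intro exI[of _ "{M0}"]) auto
next
  case (Suc s)
  then obtain \<N> where \<N>: "\<N> \<subseteq> \<M>" "finite \<N>" "\<forall>M\<in>\<M>. vanishes_up_to t w s M (\<Inter>\<N>)"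
    and bound: "\<And>n. \<forall>M\<in>\<M>. codim_le M n \<Longrightarrow> codim_le (\<Inter>\<N>) (codim_bound n s)" by blast
  define d where "d = (LEAST d. codim_le (\<Inter>\<N>) d)"
  have "finite_codim (\<Inter>\<N>)" using \<N> \<M> by (intro finite_codim_Inter) auto
  then have d: "codim_le (\<Inter>\<N>) d" unfolding d_def finite_codim_iff by (rule LeastI_ex)
  have sub: "subspace (\<Inter>\<N>)" using \<N>(1) \<M> by (intro subspace_Inter) auto
  have ident: "\<forall>M\<in>\<M>. subspace M \<and> satisfies_identity t w M" using \<M> by blast
  obtain \<M>\<^sub>0 where \<M>\<^sub>0: "\<M>\<^sub>0 \<subseteq> \<M>" "finite \<M>\<^sub>0" "card \<M>\<^sub>0 \<le> d ^ Suc s"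
    "\<forall>M\<in>\<M>. vanishes_up_to t w (Suc s) M (\<Inter>\<N> \<inter> \<Inter>\<M>\<^sub>0)"
    by (rule vanishes_up_to_step[OF w ident sub \<N>(3) d])
  have "codim_le (\<Inter>(\<N> \<union> \<M>\<^sub>0)) (codim_bound n (Suc s))" if n: "\<forall>M\<in>\<M>. codim_le M n" for n
  proof -
    have "d \<le> codim_bound n s" unfolding d_def using bound[OF n] by (rule Least_le)
    then have "card \<M>\<^sub>0 \<le> codim_bound n s ^ Suc s"
      using \<M>\<^sub>0(3) power_mono[of d "codim_bound n s" "Suc s"] by linarith
    then have "codim_bound n s + n * card \<M>\<^sub>0 \<le> codim_bound n (Suc s)" by simp
    moreover have "codim_le (\<Inter>\<N> \<inter> \<Inter>\<M>\<^sub>0) (codim_bound n s + n * card \<M>\<^sub>0)"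
      using \<M>\<^sub>0 n by (intro codim_le_Int_Inter bound) auto
    ultimately show ?thesis by (metis Inter_Un_distrib codim_le_mono)
  qed
  then show ?case using \<N> \<M>\<^sub>0 by (intro exI[of _ "\<N> \<union> \<M>\<^sub>0"]) (auto simp: Inter_Un_distrib)
qed

lemma codim_Inter_maximal_ideals:
  assumes w: "multilinear t w" and \<M>: "\<forall>M\<in>\<M>. maximal_ideal kind t w M \<and> finite_codim M"
  shows "finite_codim (\<Inter>\<M>)"
    and "\<forall>M\<in>\<M>. codim_le M n \<Longrightarrow> codim_le (\<Inter>\<M>) (codim_bound n t)"
proof -
  have "finite_codim (\<Inter>\<M>) \<and> ((\<forall>M\<in>\<M>. codim_le M n) \<longrightarrow> codim_le (\<Inter>\<M>) (codim_bound n t))"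
  proof (cases "\<M> = {}")
    case True
    then show ?thesis using codim_le_UNIV finite_codim_iff by auto
  next
    case False
    have ideal: "\<forall>M\<in>\<M>. is_ideal kind M" using \<M> by (simp add: maximal_ideal_def)
    have "\<forall>M\<in>\<M>. subspace M \<and> satisfies_identity t w M \<and> finite_codim M"
      using \<M> is_ideal_subspace by (auto simp: maximal_ideal_def)
    from vanishes_up_to_finite_Inter[OF w this False, of t]
    obtain \<N> where \<N>: "\<N> \<subseteq> \<M>" "finite \<N>" "\<forall>M\<in>\<M>. vanishes_up_to t w t M (\<Inter>\<N>)"
      and bound: "(\<forall>M\<in>\<M>. codim_le M n) \<longrightarrow> codim_le (\<Inter>\<N>) (codim_bound n t)" by blast
    have "is_ideal kind (\<Inter>\<N>)" using \<N>(1) ideal by (intro is_ideal_Inter) auto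
    then have "\<forall>M\<in>\<M>. \<Inter>\<N> \<subseteq> M" using \<M> \<N>(3) maximal_ideal_contains[OF w] by blast
    then have "\<Inter>\<N> = \<Inter>\<M>" using \<N>(1) by blast
    moreover have "finite_codim (\<Inter>\<N>)" using \<N> \<M> by (intro finite_codim_Inter) auto
    ultimately show ?thesis using bound by simp
  qed
  then show "finite_codim (\<Inter>\<M>)"
    and "\<forall>M\<in>\<M>. codim_le M n \<Longrightarrow> codim_le (\<Inter>\<M>) (codim_bound n t)" by auto
qed

end

theorem mainTheorem6:
  fixes scale :: "'f::field \<Rightarrow> 'a::ab_group_add \<Rightarrow> 'a"
    and mult :: "'a \<Rightarrow> 'a \<Rightarrow> 'a"
    and w :: "'f free_algebra"
    and t :: nat
    and kind :: ideal_kind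
  assumes "nonassoc_algebra scale mult"
    and "multilinear t w"
  shows "nonassoc_algebra.finite_codim scale
           (\<Inter>{I. nonassoc_algebra.maximal_ideal scale mult kind t w I \<and>
                nonassoc_algebra.finite_codim scale I})
       \<and> (\<forall>n. nonassoc_algebra.codim_le scale
           (\<Inter>{I. nonassoc_algebra.maximal_ideal scale mult kind t w I \<and>
                nonassoc_algebra.codim_le scale I n})
           (codim_bound n t))"
proof -
  interpret nonassoc_algebra scale mult by (rule assms(1))
  show ?thesis
  proof (intro conjI allI)
    show "finite_codim (\<Inter>{I. maximal_ideal kind t w I \<and> finite_codim I})"
      by (rule codim_Inter_maximal_ideals(1)[OF assms(2)]) auto
    show "codim_le (\<Inter>{I. maximal_ideal kind t w I \<and> codim_le I n}) (codim_bound n t)" for n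
      by (rule codim_Inter_maximal_ideals(2)[OF assms(2)]) (auto simp: finite_codim_iff)
  qed
qed

end
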